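(* Let $G=(Y\cup Z,E)$ be a bipartite graph in which every vertex of $Y$ has valency $k$ and every vertex of $Z$ has valency $\ell$. Suppose that every vertex $y\in Y$ is locally distance-regular with parameters \[ \begin{vmatrix} k; & 1, & c_2^{Y}, & c_3^{Y}, & k\end{vmatrix}, \] i.e. $y$ has eccentricity $4$ and for each $i\in\{1,2,3,4\}$ and each vertex $w$ at distance $i$ from $y$, the number of neighbours of $w$ at distance $i-1$ from $y$ equals $1,c_2^Y,c_3^Y,k$ for $i=1,2,3,4$ respectively. Suppose further that there is a constant $c_2^{Z}$ such that for every $z\in Z$ and every vertex $w$ at distance two from $z$, the number of common neighbours of $z$ and $w$ equals $c_2^Z$, and that $k>\frac{c_2^{Y}c_3^{Y}}{c_2^{Z}}$. Then $G$ is distance-biregular with intersection array \[ \begin{vmatrix} k; & 1, & c_2^{Y}, & c_3^{Y}, & k \\ \ell; & 1, & c_2^{Z}, & \frac{c_2^{Y}c_3^{Y}}{c_2^{Z}}, & \ell\end{vmatrix}. \]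
   Context: For a vertex $a$ of a graph, $N_i(a)$ denotes the set of vertices at distance $i$ from $a$. A bipartite graph with bipartition $Y\cup Z$ is distance-biregular if for every vertex $a$, every $i$, and every vertex $w$ at distance $i$ from $a$, the numbers $c_i(a)=|\{u\sim w: d(a,u)=i-1\}|$ and $b_i(a)=|\{u\sim w: d(a,u)=i+1\}|$ depend only on $i$ and on which part ($Y$ or $Z$) contains $a$; these common values are denoted $c_i^Y,b_i^Y$ (for $a\in Y$) and $c_i^Z,b_i^Z$ (for $a\in Z$). The intersection array $\begin{vmatrix} k; & c_1^{Y}, & \dots, & c_{d_Y}^{Y} \\ \ell; & c_1^{Z}, & \dots, & c_{d_Z}^{Z}\end{vmatrix}$ records the valency $k$ of vertices in $Y$, the valency $\ell$ of vertices in $Z$, and the numbers $c_i$ for $1\le i\le d_Y$ (resp. $d_Z$), where $d_Y$ (resp. $d_Z$) is the eccentricity of vertices of $Y$ (resp. $Z$). *)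

theory Defs
  imports "Graph_Theory.Shortest_Path"
begin

text \<open>
  Graphs are finite simple undirected graphs, represented as symmetric digraphs by the locale
  \<^locale>\<open>graph\<close>; thus \<^const>\<open>out_degree\<close> is the valency of a vertex.
\<close>

definition bipartition :: "('a, 'b) pre_digraph \<Rightarrow> 'a set \<Rightarrow> 'a set \<Rightarrow> bool" where
  "bipartition G Y Z \<longleftrightarrow>
     verts G = Y \<union> Z \<and> Y \<inter> Z = {} \<and>
     (\<forall>u v. u \<rightarrow>\<^bsub>G\<^esub> v \<longrightarrow> (u \<in> Y \<and> v \<in> Z) \<or> (u \<in> Z \<and> v \<in> Y))"

definition nbrs :: "('a, 'b) pre_digraph \<Rightarrow> 'a \<Rightarrow> 'a set" where
  "nbrs G v = {u. v \<rightarrow>\<^bsub>G\<^esub> u}"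

definition gdist :: "('a, 'b) pre_digraph \<Rightarrow> 'a \<Rightarrow> 'a \<Rightarrow> ereal" where
  "gdist G u v = wf_digraph.\<mu> G (\<lambda>_. 1) u v"

lemma gdist_eq_INF_length:
  assumes "wf_digraph G"
  shows "gdist G u v = (INF p \<in> {p. pre_digraph.awalk G u p v}. ereal (real (length p)))"
  unfolding gdist_def wf_digraph.\<mu>_def[OF assms]
  by (simp add: wf_digraph.awalk_cost_def[OF assms] sum_list_triv)

definition sphere_at :: "('a, 'b) pre_digraph \<Rightarrow> nat \<Rightarrow> 'a \<Rightarrow> 'a set" where
  "sphere_at G i a = {w \<in> verts G. gdist G a w = ereal (real i)}"

definition eccentricity :: "('a, 'b) pre_digraph \<Rightarrow> 'a \<Rightarrow> ereal" where
  "eccentricity G a = (SUP w \<in> verts G. gdist G a w)"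

text \<open>
  For \<open>w\<close> at distance \<open>i\<close> from \<open>a\<close>, the following are the numbers \<open>c\<^sub>i(a)\<close> and \<open>b\<^sub>i(a)\<close>, computed
  at \<open>w\<close>. The subtraction \<open>i - 1\<close> is the one of real numbers, so \<open>c\<^sub>0(a) = 0\<close>.
\<close>

definition c_num :: "('a, 'b) pre_digraph \<Rightarrow> 'a \<Rightarrow> nat \<Rightarrow> 'a \<Rightarrow> nat" where
  "c_num G a i w = card {u \<in> nbrs G w. gdist G a u = ereal (real i - 1)}"

definition b_num :: "('a, 'b) pre_digraph \<Rightarrow> 'a \<Rightarrow> nat \<Rightarrow> 'a \<Rightarrow> nat" where
  "b_num G a i w = card {u \<in> nbrs G w. gdist G a u = ereal (real i + 1)}"

definition distance_biregular :: "('a, 'b) pre_digraph \<Rightarrow> 'a set \<Rightarrow> 'a set \<Rightarrow> bool" where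
  "distance_biregular G Y Z \<longleftrightarrow>
     graph G \<and> bipartition G Y Z \<and>
     (\<forall>P \<in> {Y, Z}. \<exists>c b :: nat \<Rightarrow> nat. \<forall>a \<in> P. \<forall>i. \<forall>w \<in> sphere_at G i a.
        c_num G a i w = c i \<and> b_num G a i w = b i)"

text \<open>
  The list \<open>[c\<^sub>1, \<dots>, c\<^sub>d]\<close> holds one row of an intersection array without the leading valency. Its
  entries are real numbers because they may be given by quotients such as
  \<open>c\<^sub>2\<^sup>Y c\<^sub>3\<^sup>Y / c\<^sub>2\<^sup>Z\<close>; that they are integers is part of the assertion.
\<close>

definition locally_distance_regular ::
    "('a, 'b) pre_digraph \<Rightarrow> 'a \<Rightarrow> nat \<Rightarrow> real list \<Rightarrow> bool" where
  "locally_distance_regular G a k cs \<longleftrightarrow>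
     out_degree G a = k \<and>
     eccentricity G a = ereal (real (length cs)) \<and>
     (\<forall>i \<in> {1..length cs}. \<forall>w \<in> sphere_at G i a. real (c_num G a i w) = cs ! (i - 1))"

definition has_intersection_array ::
    "('a, 'b) pre_digraph \<Rightarrow> 'a set \<Rightarrow> 'a set \<Rightarrow> nat \<Rightarrow> real list \<Rightarrow> nat \<Rightarrow> real list \<Rightarrow> bool" where
  "has_intersection_array G Y Z k cY l cZ \<longleftrightarrow>
     (\<forall>y \<in> Y. locally_distance_regular G y k cY) \<and>
     (\<forall>z \<in> Z. locally_distance_regular G z l cZ)"

end

theory Submission
  imports Defs "Graph_Theory.Digraph_Component"
begin

text \<open>
  The walks of length three between \<open>z \<in> Z\<close> and a vertex \<open>y\<close> at distance three can be counted from
  either end: \<open>y\<close> sees \<open>c\<^sub>3\<^sup>Y c\<^sub>2\<^sup>Y\<close> of them and \<open>z\<close> sees \<open>c\<^sub>3(z) c\<^sub>2\<^sup>Z\<close>, which determines \<open>c\<^sub>3(z)\<close>. Since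
  vertices of \<open>Y\<close> have eccentricity four, parity bounds the distance between \<open>Y\<close> and \<open>Z\<close> by three,
  so \<open>z\<close> has eccentricity at most four and all neighbours of a vertex at distance four are at
  distance three. The inequality \<open>k > c\<^sub>3(z)\<close> makes distance four occur.
\<close>

context wf_digraph
begin

lemma ex_awalk_length_iff_relpow:
  assumes "u \<in> verts G"
  shows "(\<exists>p. awalk u p v \<and> length p = n) \<longleftrightarrow> (u, v) \<in> arcs_ends G ^^ n"
  using assms
proof (induction n arbitrary: u)
  case 0
  then show ?case by (auto simp: awalk_Nil_iff)
next
  case (Suc n)
  have "(\<exists>p. awalk u p v \<and> length p = Suc n) \<longleftrightarrow>
      (\<exists>e p. e \<in> arcs G \<and> u = tail G e \<and> awalk (head G e) p v \<and> length p = n)"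
    unfolding length_Suc_conv by (metis awalk_Cons_iff)
  also have "\<dots> \<longleftrightarrow> (\<exists>w. u \<rightarrow>\<^bsub>G\<^esub> w \<and> (\<exists>p. awalk w p v \<and> length p = n))"
    by (auto simp: arcs_ends_conv)
  also have "\<dots> \<longleftrightarrow> (\<exists>w. u \<rightarrow>\<^bsub>G\<^esub> w \<and> (w, v) \<in> arcs_ends G ^^ n)"
    using Suc.IH adj_in_verts by blast
  also have "\<dots> \<longleftrightarrow> (u, v) \<in> arcs_ends G ^^ Suc n"
    by (meson relpow_Suc_D2 relpow_Suc_I2)
  finally show ?case .
qed

definition ndist :: "'a \<Rightarrow> 'a \<Rightarrow> nat" where
  "ndist u v = (LEAST n. (u, v) \<in> arcs_ends G ^^ n)"

lemma ndist_le: "(u, v) \<in> arcs_ends G ^^ n \<Longrightarrow> ndist u v \<le> n"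
  unfolding ndist_def by (rule Least_le)

lemma relpow_ndist:
  assumes "u \<rightarrow>\<^sup>* v"
  shows "(u, v) \<in> arcs_ends G ^^ ndist u v"
proof -
  obtain p where "awalk u p v"
    using assms by (auto simp: reachable_awalk)
  then have "(u, v) \<in> arcs_ends G ^^ length p"
    using ex_awalk_length_iff_relpow by blast
  then show ?thesis
    unfolding ndist_def by (rule LeastI)
qed

lemma gdist_eq_ndist:
  assumes "u \<rightarrow>\<^sup>* v"
  shows "gdist G u v = ereal (real (ndist u v))"
  unfolding gdist_eq_INF_length[OF wf_digraph]
proof (rule antisym)
  have "u \<in> verts G"
    using assms by (rule reachable_in_verts)
  then obtain p where "awalk u p v" "length p = ndist u v"
    using relpow_ndist[OF assms] ex_awalk_length_iff_relpow by blast
  then show "(INF p \<in> {p. awalk u p v}. ereal (real (length p))) \<le> ereal (real (ndist u v))"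
    by (intro INF_lower2[of p]) auto
  have "ndist u v \<le> length p" if "awalk u p v" for p
    using that ex_awalk_length_iff_relpow by (blast intro: ndist_le)
  then show "ereal (real (ndist u v)) \<le> (INF p \<in> {p. awalk u p v}. ereal (real (length p)))"
    by (intro INF_greatest) simp
qed

lemma nbrs_in_verts: "u \<in> nbrs G v \<Longrightarrow> u \<in> verts G"
  by (auto simp: nbrs_def dest: adj_in_verts)

lemma c_num_0: "c_num G a 0 w = 0"
proof -
  have "gdist G a u \<noteq> ereal (- 1)" for u
  proof -
    have "0 \<le> gdist G a u"
      unfolding gdist_eq_INF_length[OF wf_digraph] by (intro INF_greatest) simp
    then show ?thesis by auto
  qed
  then show ?thesis
    by (simp add: c_num_def)
qed

lemma c_num_Suc: "c_num G a (Suc i) w = card (nbrs G w \<inter> sphere_at G i a)"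
  unfolding c_num_def sphere_at_def
  by (rule arg_cong[where f = card]) (auto dest: nbrs_in_verts)

lemma b_num_eq: "b_num G a i w = card (nbrs G w \<inter> sphere_at G (Suc i) a)"
  unfolding b_num_def sphere_at_def
  by (rule arg_cong[where f = card]) (auto simp: add.commute dest: nbrs_in_verts)

lemma locally_distance_regular_c_num_eq_nth:
  assumes "locally_distance_regular G a k cs" "w \<in> sphere_at G i a"
  shows "real (c_num G a i w) = (0 # cs) ! i"
proof (cases i)
  case 0
  then show ?thesis by (simp add: c_num_0)
next
  case (Suc j)
  have "w \<in> verts G"
    using assms(2) by (simp add: sphere_at_def)
  then have "gdist G a w \<le> eccentricity G a"
    unfolding eccentricity_def by (rule SUP_upper)
  then have "i \<le> length cs"
    using assms by (simp add: locally_distance_regular_def sphere_at_def)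
  then show ?thesis
    using assms Suc by (simp add: locally_distance_regular_def)
qed

end

lemma (in fin_digraph) finite_nbrs [simp]: "finite (nbrs G v)"
  by (rule finite_subset[OF _ finite_verts]) (auto dest: nbrs_in_verts)

lemma (in nomulti_digraph) out_degree_eq_card_nbrs: "out_degree G v = card (nbrs G v)"
proof -
  have "nbrs G v = head G ` out_arcs G v"
    by (auto simp: nbrs_def arcs_ends_conv)
  moreover have "inj_on (head G) (out_arcs G v)"
    by (rule inj_onI) (auto simp: arc_to_ends_def intro: no_multi_arcs)
  ultimately show ?thesis
    by (simp add: out_degree_def card_image)
qed

context sym_digraph
begin

lemma nbrs_commute: "u \<in> nbrs G v \<longleftrightarrow> v \<in> nbrs G u"
  using arcs_ends_symmetric[OF sym_arcs] by (auto simp: nbrs_def)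

lemma connected_if_eccentricity_finite:
  assumes "a \<in> verts G" "eccentricity G a \<noteq> \<infinity>"
  shows "Digraph_Component.connected G"
proof -
  have reachable_from_a: "a \<rightarrow>\<^sup>* w" if "w \<in> verts G" for w
  proof -
    have "gdist G a w \<le> eccentricity G a"
      unfolding eccentricity_def using that by (rule SUP_upper)
    then have "gdist G a w < \<infinity>"
      using assms(2) by auto
    then show ?thesis
      unfolding gdist_def \<mu>_reach_conv .
  qed
  have "u \<rightarrow>\<^sup>* v" if "u \<in> verts G" "v \<in> verts G" for u v
    using symmetric_reachable'[OF reachable_from_a[OF that(1)]] reachable_from_a[OF that(2)]
    by (rule reachable_trans)
  then show ?thesis
    using assms(1) by (blast intro: connectedI reachable_mk_symmetricI)
qed

end

fun num_walks :: "('a, 'b) pre_digraph \<Rightarrow> nat \<Rightarrow> 'a \<Rightarrow> 'a \<Rightarrow> nat" where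
  "num_walks G 0 u v = of_bool (u = v)"
| "num_walks G (Suc n) u v = (\<Sum>w \<in> nbrs G u. num_walks G n w v)"

lemma (in fin_digraph) num_walks_eq_0_iff:
  "num_walks G n u v = 0 \<longleftrightarrow> (u, v) \<notin> arcs_ends G ^^ n"
proof (induction n arbitrary: u)
  case (Suc n)
  have "num_walks G (Suc n) u v = 0 \<longleftrightarrow> (\<forall>w \<in> nbrs G u. (w, v) \<notin> arcs_ends G ^^ n)"
    using Suc.IH by simp
  also have "\<dots> \<longleftrightarrow> (u, v) \<notin> arcs_ends G ^^ Suc n"
    unfolding nbrs_def by (blast intro: relpow_Suc_I2 dest: relpow_Suc_D2)
  finally show ?case .
qed simp

context pseudo_graph
begin

lemma num_walks_Suc_right:
  "num_walks G (Suc n) u v = (\<Sum>w \<in> nbrs G v. num_walks G n u w)"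
proof (induction n arbitrary: u)
  case 0
  show ?case
    using nbrs_commute[of u v] by (auto simp: of_bool_def Int_insert_right)
next
  case (Suc n)
  have "num_walks G (Suc (Suc n)) u v = (\<Sum>w \<in> nbrs G u. \<Sum>x \<in> nbrs G v. num_walks G n w x)"
    by (simp only: Suc.IH num_walks.simps(2)[of _ "Suc n"])
  also have "\<dots> = (\<Sum>x \<in> nbrs G v. num_walks G (Suc n) u x)"
    by (subst sum.swap) simp
  finally show ?case .
qed

lemma num_walks_commute: "num_walks G n u v = num_walks G n v u"
proof (induction n arbitrary: u)
  case (Suc n)
  then show ?case
    by (simp only: num_walks_Suc_right[of n v u]) simp
qed auto

lemma ndist_commute: "ndist u v = ndist v u"
  unfolding ndist_def using num_walks_commute num_walks_eq_0_iff by metis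

end

locale connected_graph = graph +
  assumes connected: "Digraph_Component.connected G"
begin

lemma reachable_if_verts: "u \<in> verts G \<Longrightarrow> v \<in> verts G \<Longrightarrow> u \<rightarrow>\<^sup>* v"
  using connected reachable_mk_symmetric_eq[OF sym_arcs] by (auto simp: Digraph_Component.connected_def)

lemma mem_sphere_at_iff:
  assumes "a \<in> verts G"
  shows "w \<in> sphere_at G i a \<longleftrightarrow> w \<in> verts G \<and> ndist a w = i"
  using assms by (auto simp: sphere_at_def gdist_eq_ndist reachable_if_verts)

lemma ndist_eq_0_iff:
  assumes "u \<in> verts G" "v \<in> verts G"
  shows "ndist u v = 0 \<longleftrightarrow> u = v"
  using relpow_ndist[OF reachable_if_verts[OF assms]] ndist_le[of u v 0] by auto

lemma ndist_nbr_le: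
  assumes "a \<in> verts G" "u \<in> nbrs G w"
  shows "ndist a u \<le> Suc (ndist a w)"
proof (rule ndist_le)
  have "w \<rightarrow>\<^bsub>G\<^esub> u" "w \<in> verts G"
    using assms(2) adj_in_verts by (auto simp: nbrs_def)
  then show "(a, u) \<in> arcs_ends G ^^ Suc (ndist a w)"
    using relpow_ndist[OF reachable_if_verts[OF assms(1)]] by (auto intro: relpow_Suc_I)
qed

lemma ndist_predE:
  assumes "a \<in> verts G" "w \<in> verts G" "ndist a w = Suc n"
  obtains u where "u \<in> nbrs G w" "ndist a u = n"
proof -
  obtain u where u: "(a, u) \<in> arcs_ends G ^^ n" "u \<rightarrow>\<^bsub>G\<^esub> w"
    using relpow_ndist[OF reachable_if_verts[OF assms(1,2)]] assms(3) by auto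
  then have "w \<in> nbrs G u"
    by (simp add: nbrs_def)
  then have "u \<in> nbrs G w" "n \<le> ndist a u"
    using ndist_nbr_le[OF assms(1)] assms(3) nbrs_commute by fastforce+
  then show thesis
    using that ndist_le[OF u(1)] by simp
qed

lemma sphere_at_0: "a \<in> verts G \<Longrightarrow> sphere_at G 0 a = {a}"
  by (auto simp: mem_sphere_at_iff ndist_eq_0_iff)

lemma sphere_at_1:
  assumes "a \<in> verts G"
  shows "sphere_at G 1 a = nbrs G a"
proof (intro equalityI subsetI)
  fix w assume "w \<in> sphere_at G 1 a"
  then have "w \<in> verts G" "ndist a w = Suc 0"
    using assms by (auto simp: mem_sphere_at_iff)
  then obtain u where u: "u \<in> nbrs G w" "ndist a u = 0"
    using ndist_predE[OF assms] by blast
  then show "w \<in> nbrs G a"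
    using assms nbrs_in_verts nbrs_commute ndist_eq_0_iff by metis
next
  fix w assume w: "w \<in> nbrs G a"
  then have "w \<noteq> a" "w \<in> verts G"
    using adj_not_same nbrs_in_verts by (auto simp: nbrs_def)
  moreover have "ndist a w \<le> 1"
    using ndist_nbr_le[OF assms w] ndist_eq_0_iff[OF assms assms] by simp
  ultimately show "w \<in> sphere_at G 1 a"
    using assms ndist_eq_0_iff[OF assms] by (auto simp: mem_sphere_at_iff le_Suc_eq)
qed

lemma c_num_1:
  assumes "a \<in> verts G" "w \<in> sphere_at G 1 a"
  shows "c_num G a 1 w = 1"
proof -
  have "nbrs G w \<inter> sphere_at G 0 a = {a}"
    using assms nbrs_commute[of a w] by (auto simp: sphere_at_0 sphere_at_1 simp del: One_nat_def)
  then show ?thesis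
    using c_num_Suc[of a 0 w] by simp
qed

lemma c_num_2:
  assumes "a \<in> verts G"
  shows "c_num G a 2 w = card (nbrs G a \<inter> nbrs G w)"
  using c_num_Suc[of a 1 w] sphere_at_1[OF assms] by (simp add: Int_commute numeral_2_eq_2)

lemma c_num_Suc_pos:
  assumes "a \<in> verts G" "w \<in> sphere_at G (Suc i) a"
  shows "c_num G a (Suc i) w > 0"
proof -
  obtain u where "u \<in> nbrs G w" "ndist a u = i"
    using assms ndist_predE mem_sphere_at_iff by metis
  then have "u \<in> nbrs G w \<inter> sphere_at G i a"
    using assms(1) by (simp add: mem_sphere_at_iff nbrs_in_verts)
  then show ?thesis
    by (auto simp: c_num_Suc card_gt_0_iff)
qed

lemma eccentricity_eq_iff:
  assumes "a \<in> verts G"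
  shows "eccentricity G a = ereal (real n) \<longleftrightarrow>
    (\<forall>w \<in> verts G. ndist a w \<le> n) \<and> (\<exists>w \<in> verts G. ndist a w = n)"
proof -
  have "eccentricity G a = Max (gdist G a ` verts G)"
    unfolding eccentricity_def using assms by (intro cSup_eq_Max) auto
  then have "eccentricity G a = ereal (real n) \<longleftrightarrow>
      ereal (real n) \<in> gdist G a ` verts G \<and> (\<forall>x \<in> gdist G a ` verts G. x \<le> ereal (real n))"
    using assms by (subst Max_eq_iff[symmetric]) auto
  then show ?thesis
    using assms by (auto simp: gdist_eq_ndist reachable_if_verts image_iff)
qed

lemma locally_distance_regular_eccentricity_4_iff:
  assumes "a \<in> verts G"
  shows "locally_distance_regular G a k [1, c2, c3, c4] \<longleftrightarrow>
    out_degree G a = k \<and> eccentricity G a = ereal (real 4) \<and>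
    (\<forall>w \<in> sphere_at G 2 a. real (c_num G a 2 w) = c2) \<and>
    (\<forall>w \<in> sphere_at G 3 a. real (c_num G a 3 w) = c3) \<and>
    (\<forall>w \<in> sphere_at G 4 a. real (c_num G a 4 w) = c4)"
proof -
  have "{1..4::nat} = {1, 2, 3, 4}" by auto
  then show ?thesis
    using c_num_1[OF assms] by (simp add: locally_distance_regular_def numeral_eq_Suc)
qed

lemma num_walks_to_sphere_Suc:
  assumes a: "a \<in> verts G" and w: "w \<in> sphere_at G (Suc n) a"
    and const: "\<And>u. u \<in> sphere_at G n a \<Longrightarrow> num_walks G n a u = m"
  shows "num_walks G (Suc n) a w = c_num G a (Suc n) w * m"
proof -
  have no_walks: "num_walks G n a u = 0" if u: "u \<in> nbrs G w - sphere_at G n a" for u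
  proof -
    have "ndist a w \<le> Suc (ndist a u)"
      using u a ndist_nbr_le nbrs_commute by blast
    moreover have "ndist a u \<noteq> n"
      using u a nbrs_in_verts by (auto simp: mem_sphere_at_iff)
    ultimately have "n < ndist a u"
      using w a by (simp add: mem_sphere_at_iff)
    then show ?thesis
      using ndist_le[of a u n] by (auto simp: num_walks_eq_0_iff)
  qed
  have "num_walks G (Suc n) a w = (\<Sum>u \<in> nbrs G w. num_walks G n a u)"
    by (rule num_walks_Suc_right)
  also have "\<dots> = (\<Sum>u \<in> nbrs G w \<inter> sphere_at G n a. num_walks G n a u)"
    using no_walks by (intro sum.mono_neutral_right) auto
  also have "\<dots> = c_num G a (Suc n) w * m"
    using const by (simp add: c_num_Suc)
  finally show ?thesis .
qed

lemma num_walks_to_sphere: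
  assumes "a \<in> verts G"
    and "\<And>i w. i \<in> {1..n} \<Longrightarrow> w \<in> sphere_at G i a \<Longrightarrow> c_num G a i w = c i"
    and "w \<in> sphere_at G n a"
  shows "num_walks G n a w = (\<Prod>i = 1..n. c i)"
  using assms(2,3)
proof (induction n arbitrary: w)
  case 0
  then show ?case
    using assms(1) by (simp add: sphere_at_0)
next
  case (Suc n)
  have "num_walks G (Suc n) a w = c_num G a (Suc n) w * (\<Prod>i = 1..n. c i)"
    using Suc by (intro num_walks_to_sphere_Suc[OF assms(1)]) auto
  then show ?case
    using Suc.prems by (simp add: mult.commute)
qed

text \<open>Both sides count the walks of length \<open>n + 1\<close> from \<open>a\<close> to \<open>b\<close>.\<close>

lemma c_num_times_prod_commute:
  assumes "a \<in> verts G" "b \<in> sphere_at G (Suc n) a"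
    and "\<And>i w. i \<in> {1..n} \<Longrightarrow> w \<in> sphere_at G i a \<Longrightarrow> c_num G a i w = ca i"
    and "\<And>i w. i \<in> {1..n} \<Longrightarrow> w \<in> sphere_at G i b \<Longrightarrow> c_num G b i w = cb i"
  shows "c_num G a (Suc n) b * (\<Prod>i = 1..n. ca i) = c_num G b (Suc n) a * (\<Prod>i = 1..n. cb i)"
proof -
  have b: "b \<in> verts G" "a \<in> sphere_at G (Suc n) b"
    using assms(1,2) ndist_commute[of a b] by (auto simp: mem_sphere_at_iff)
  have "num_walks G (Suc n) a b = c_num G a (Suc n) b * (\<Prod>i = 1..n. ca i)"
    using assms by (intro num_walks_to_sphere_Suc num_walks_to_sphere) auto
  moreover have "num_walks G (Suc n) b a = c_num G b (Suc n) a * (\<Prod>i = 1..n. cb i)"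
    using assms b by (intro num_walks_to_sphere_Suc num_walks_to_sphere) auto
  ultimately show ?thesis
    using num_walks_commute by metis
qed

lemma c_num_3_eq_quotient:
  assumes a: "a \<in> verts G" and b: "b \<in> sphere_at G 3 a"
    and ca: "\<And>w. w \<in> sphere_at G 2 a \<Longrightarrow> c_num G a 2 w = ca"
    and cb: "\<And>w. w \<in> sphere_at G 2 b \<Longrightarrow> c_num G b 2 w = cb"
  shows "real (c_num G a 3 b) = real cb * real (c_num G b 3 a) / real ca"
proof -
  have b_verts: "b \<in> verts G" and dist: "ndist a b = Suc 2"
    using a b by (auto simp: mem_sphere_at_iff)
  obtain w where "w \<in> nbrs G b" "ndist a w = 2"
    using ndist_predE[OF a b_verts dist] .
  then have w: "w \<in> sphere_at G 2 a"
    using a by (simp add: mem_sphere_at_iff nbrs_in_verts)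
  then have "ca > 0"
    using c_num_Suc_pos[OF a, of w 1] ca[OF w] by (simp add: numeral_2_eq_2)
  moreover have c_num_le_2: "c_num G x i u = (if i = 1 then 1 else c)"
    if "x \<in> verts G" "\<And>u. u \<in> sphere_at G 2 x \<Longrightarrow> c_num G x 2 u = c"
      "i \<in> {1..2}" "u \<in> sphere_at G i x" for x c i u
  proof (cases "i = 1")
    case True
    then show ?thesis
      using that(4) c_num_1[OF that(1), of u] by simp
  next
    case False
    then have "i = 2"
      using that(3) by auto
    then show ?thesis
      using that(2,4) by simp
  qed
  have "c_num G a (Suc 2) b * (\<Prod>i = 1..2. if i = (1::nat) then 1 else ca)
      = c_num G b (Suc 2) a * (\<Prod>i = 1..2. if i = (1::nat) then 1 else cb)"
    using b
    by (intro c_num_times_prod_commute[OF a] c_num_le_2[OF a ca] c_num_le_2[OF b_verts cb]) simp_all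
  then have "c_num G a 3 b * ca = c_num G b 3 a * cb"
    by (simp add: numeral_eq_Suc)
  ultimately show ?thesis
    by (simp add: field_simps flip: of_nat_mult)
qed

end

locale connected_bipartite_graph = connected_graph +
  fixes Y Z :: "'a set"
  assumes bipartition: "bipartition G Y Z"
begin

lemma verts_eq: "verts G = Y \<union> Z" and parts_disjoint: "Y \<inter> Z = {}"
  using bipartition by (auto simp: bipartition_def)

lemma mem_Y_iff_nbr_notin: "u \<in> nbrs G w \<Longrightarrow> w \<in> Y \<longleftrightarrow> u \<notin> Y"
  using bipartition unfolding bipartition_def nbrs_def by blast

lemma even_ndist_iff:
  assumes "u \<in> verts G" "v \<in> verts G"
  shows "even (ndist u v) \<longleftrightarrow> (u \<in> Y \<longleftrightarrow> v \<in> Y)"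
proof -
  have "even n \<longleftrightarrow> (u \<in> Y \<longleftrightarrow> v \<in> Y)" if "(u, v) \<in> arcs_ends G ^^ n" for n
    using that
  proof (induction n arbitrary: v)
    case (Suc n)
    then obtain w where "(u, w) \<in> arcs_ends G ^^ n" "w \<rightarrow>\<^bsub>G\<^esub> v" by auto
    then show ?case
      using Suc.IH mem_Y_iff_nbr_notin[of v w] by (auto simp: nbrs_def)
  qed auto
  then show ?thesis
    using relpow_ndist[OF reachable_if_verts[OF assms]] by blast
qed

lemma ndist_nbr_cases:
  assumes "a \<in> verts G" "u \<in> nbrs G w"
  obtains "ndist a u = Suc (ndist a w)" | "ndist a w = Suc (ndist a u)"
proof -
  have "w \<in> nbrs G u"
    using assms(2) nbrs_commute by blast
  moreover have "even (ndist a u) \<noteq> even (ndist a w)"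
    using mem_Y_iff_nbr_notin[OF assms(2)] assms(1) nbrs_in_verts[OF assms(2)]
      nbrs_in_verts[OF \<open>w \<in> nbrs G u\<close>]
    by (auto simp: even_ndist_iff)
  ultimately show thesis
    using that assms ndist_nbr_le[of a u w] ndist_nbr_le[of a w u] by (auto simp: le_Suc_eq)
qed

lemma c_num_plus_b_num:
  assumes "a \<in> verts G" "w \<in> sphere_at G i a"
  shows "c_num G a i w + b_num G a i w = out_degree G w"
proof (cases i)
  case 0
  then have "nbrs G w \<inter> sphere_at G (Suc i) a = nbrs G w"
    using assms sphere_at_0 sphere_at_1 by auto
  then show ?thesis
    using 0 by (simp add: c_num_0 b_num_eq out_degree_eq_card_nbrs)
next
  case (Suc j)
  have "u \<in> sphere_at G j a \<union> sphere_at G (Suc i) a" if "u \<in> nbrs G w" for u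
    using assms(1) that
    by (rule ndist_nbr_cases) (use assms Suc that in \<open>auto simp: mem_sphere_at_iff nbrs_in_verts\<close>)
  then have "nbrs G w = (nbrs G w \<inter> sphere_at G j a) \<union> (nbrs G w \<inter> sphere_at G (Suc i) a)"
    by auto
  then have "out_degree G w =
      card ((nbrs G w \<inter> sphere_at G j a) \<union> (nbrs G w \<inter> sphere_at G (Suc i) a))"
    unfolding out_degree_eq_card_nbrs by (rule arg_cong)
  also have "\<dots> = c_num G a i w + b_num G a i w"
    using assms(1) Suc
    by (subst card_Un_disjoint) (auto simp: c_num_Suc b_num_eq mem_sphere_at_iff)
  finally show ?thesis by simp
qed

lemma c_num_eq_out_degree:
  assumes "a \<in> verts G" "eccentricity G a = ereal (real n)" "w \<in> sphere_at G n a"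
  shows "c_num G a n w = out_degree G w"
proof -
  have "sphere_at G (Suc n) a = {}"
    using assms(1,2) by (force simp: mem_sphere_at_iff eccentricity_eq_iff simp del: of_nat_Suc)
  then have "b_num G a n w = 0"
    by (simp add: b_num_eq)
  then show ?thesis
    using c_num_plus_b_num[OF assms(1,3)] by simp
qed

lemma swap_parts: "connected_bipartite_graph G Z Y"
  using bipartition by unfold_locales (auto simp: bipartition_def)

lemma ex_intersection_numbers:
  assumes "has_intersection_array G Y Z k cY l cZ"
  shows "\<exists>c b :: nat \<Rightarrow> nat. \<forall>a \<in> Y. \<forall>i. \<forall>w \<in> sphere_at G i a.
    c_num G a i w = c i \<and> b_num G a i w = b i"
proof -
  define c where "c i = nat \<lfloor>(0 # cY) ! i\<rfloor>" for i
  define b where "b i = (if even i then k else l) - c i" for i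
  have "c_num G a i w = c i \<and> b_num G a i w = b i"
    if a: "a \<in> Y" and w: "w \<in> sphere_at G i a" for a i w
  proof -
    have verts: "a \<in> verts G" "w \<in> verts G" "ndist a w = i"
      using a w verts_eq by (auto simp: mem_sphere_at_iff)
    have "real (c_num G a i w) = (0 # cY) ! i"
      using assms a w locally_distance_regular_c_num_eq_nth by (auto simp: has_intersection_array_def)
    then have "c_num G a i w = c i"
      unfolding c_def by (metis floor_of_nat nat_int)
    moreover have "out_degree G w = (if even i then k else l)"
      using assms a verts even_ndist_iff[of a w] verts_eq
      by (auto simp: has_intersection_array_def locally_distance_regular_def)
    ultimately show ?thesis
      using c_num_plus_b_num[OF verts(1) w] by (simp add: b_def)
  qed
  then show ?thesis by blast
qed

lemma distance_biregular_if_has_intersection_array: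
  assumes "has_intersection_array G Y Z k cY l cZ"
  shows "distance_biregular G Y Z"
proof -
  interpret swapped: connected_bipartite_graph G Z Y
    by (rule swap_parts)
  have swapped_array: "has_intersection_array G Z Y l cZ k cY"
    using assms by (simp add: has_intersection_array_def)
  show ?thesis
    using ex_intersection_numbers[OF assms] swapped.ex_intersection_numbers[OF swapped_array]
      bipartition graph_axioms
    unfolding distance_biregular_def by auto
qed

lemma ndist_le_from_other_part:
  assumes Y_bound: "\<And>y w. y \<in> Y \<Longrightarrow> w \<in> verts G \<Longrightarrow> ndist y w \<le> n" and "even n"
    and z: "z \<in> Z" and w: "w \<in> verts G"
  shows "ndist z w \<le> n"
proof (cases "w \<in> Y")
  case True
  then show ?thesis
    using Y_bound z w verts_eq ndist_commute[of z w] by auto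
next
  case False
  have z_verts: "z \<in> verts G" and z_notin: "z \<notin> Y"
    using z verts_eq parts_disjoint by auto
  show ?thesis
  proof (cases "ndist z w")
    case (Suc m)
    obtain u where u: "u \<in> nbrs G w" "ndist z u = m"
      using ndist_predE[OF z_verts w Suc] .
    then have "u \<in> Y" "u \<in> verts G"
      using False mem_Y_iff_nbr_notin nbrs_in_verts by blast+
    then have "m \<le> n" "odd m"
      using Y_bound u(2) z_verts z_notin ndist_commute[of z u] even_ndist_iff[of z u] by auto
    then show ?thesis
      using Suc \<open>even n\<close> by (cases "m = n") auto
  qed simp
qed

lemma ndist_from_other_part_attainedE:
  assumes Y_eccentricity: "\<And>y. y \<in> Y \<Longrightarrow> eccentricity G y = ereal (real (Suc n))" and "odd n"
    and "Y \<noteq> {}" and z: "z \<in> Z"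
  obtains w where "w \<in> Y" "ndist z w = n"
proof -
  have Y_verts: "y \<in> verts G" if "y \<in> Y" for y
    using that verts_eq by auto
  have z_verts: "z \<in> verts G" and z_notin: "z \<notin> Y"
    using z verts_eq parts_disjoint by auto
  obtain y' where y': "y' \<in> Y"
    using \<open>Y \<noteq> {}\<close> by auto
  then have "odd (ndist y' z)"
    using Y_verts z_verts z_notin by (auto simp: even_ndist_iff)
  then obtain m where "ndist y' z = Suc m"
    by (auto elim: oddE)
  then obtain y where y: "y \<in> nbrs G z"
    using ndist_predE[OF Y_verts[OF y'] z_verts] by metis
  then have "y \<in> Y"
    using mem_Y_iff_nbr_notin z_notin by blast
  then obtain w where w: "w \<in> verts G" "ndist y w = Suc n"
    using Y_eccentricity Y_verts eccentricity_eq_iff by blast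
  then have "w \<in> Y"
    using even_ndist_iff[of y w] \<open>y \<in> Y\<close> Y_verts \<open>odd n\<close> by auto
  then have "odd (ndist w z)"
    using w(1) z_verts z_notin by (simp add: even_ndist_iff)
  moreover have "ndist w z \<le> Suc n"
    using Y_eccentricity[OF \<open>w \<in> Y\<close>] w(1) z_verts eccentricity_eq_iff by blast
  moreover have "n \<le> ndist w z"
    using ndist_nbr_le[OF w(1) y] w ndist_commute[of w y] by simp
  ultimately have "ndist z w = n"
    using \<open>odd n\<close> ndist_commute[of z w] by (auto simp: le_Suc_eq)
  then show thesis
    using that \<open>w \<in> Y\<close> by blast
qed

lemma eccentricity_of_other_part:
  assumes Y_eccentricity: "\<And>y. y \<in> Y \<Longrightarrow> eccentricity G y = ereal (real (Suc n))" and "odd n"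
    and "Y \<noteq> {}" and z: "z \<in> Z"
    and c_less_degree: "\<And>w. w \<in> sphere_at G n z \<Longrightarrow> c_num G z n w < out_degree G w"
  shows "eccentricity G z = ereal (real (Suc n))"
proof -
  have z_verts: "z \<in> verts G"
    using z verts_eq by auto
  obtain y where y: "y \<in> Y" "ndist z y = n"
    using ndist_from_other_part_attainedE[OF Y_eccentricity \<open>odd n\<close> \<open>Y \<noteq> {}\<close> z] .
  then have sphere: "y \<in> sphere_at G n z"
    using z_verts verts_eq by (auto simp: mem_sphere_at_iff)
  then have "b_num G z n y \<noteq> 0"
    using c_less_degree[OF sphere] c_num_plus_b_num[OF z_verts sphere] by simp
  then have "sphere_at G (Suc n) z \<noteq> {}"
    by (auto simp: b_num_eq)
  then obtain w where "w \<in> verts G" "ndist z w = Suc n"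
    using z_verts by (auto simp: mem_sphere_at_iff)
  moreover have "ndist y w \<le> Suc n" if "y \<in> Y" "w \<in> verts G" for y w
    using that Y_eccentricity verts_eq eccentricity_eq_iff by blast
  then have "\<forall>w \<in> verts G. ndist z w \<le> Suc n"
    using \<open>odd n\<close> z ndist_le_from_other_part[of "Suc n" z] by auto
  ultimately show ?thesis
    using z_verts eccentricity_eq_iff by blast
qed

lemma locally_distance_regular_of_other_part:
  assumes Y_regular: "\<And>y. y \<in> Y \<Longrightarrow> locally_distance_regular G y k [1, real c2Y, real c3Y, real k]"
    and Z_degree: "\<And>z. z \<in> Z \<Longrightarrow> out_degree G z = l"
    and common_nbrs: "\<And>w. w \<in> sphere_at G 2 z \<Longrightarrow> card (nbrs G z \<inter> nbrs G w) = c2Z"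
    and quotient_less: "real c2Y * real c3Y / real c2Z < real k"
    and "Y \<noteq> {}" and z: "z \<in> Z"
  shows "locally_distance_regular G z l [1, real c2Z, real c2Y * real c3Y / real c2Z, real l]"
proof -
  have z_verts: "z \<in> verts G" and z_notin: "z \<notin> Y"
    using z verts_eq parts_disjoint by auto
  have Y_params: "out_degree G y = k" "eccentricity G y = ereal (real 4)"
      "w \<in> sphere_at G 2 y \<Longrightarrow> c_num G y 2 w = c2Y"
      "w \<in> sphere_at G 3 y \<Longrightarrow> c_num G y 3 w = c3Y" if "y \<in> Y" for y w
    using Y_regular[OF that] that verts_eq locally_distance_regular_eccentricity_4_iff[of y] by auto
  have c2_eq: "c_num G z 2 w = c2Z" if "w \<in> sphere_at G 2 z" for w
    using common_nbrs[OF that] c_num_2[OF z_verts] by simp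
  have sphere_3: "y \<in> Y" "z \<in> sphere_at G 3 y" if "y \<in> sphere_at G 3 z" for y
    using that z_verts z_notin even_ndist_iff[of z y] ndist_commute[of z y]
    by (auto simp: mem_sphere_at_iff)
  have c3_eq: "real (c_num G z 3 y) = real c2Y * real c3Y / real c2Z"
    if y: "y \<in> sphere_at G 3 z" for y
    using c_num_3_eq_quotient[OF z_verts y c2_eq Y_params(3)] sphere_3[OF y] Y_params(4) by simp
  have "c_num G z 3 y < out_degree G y" if y: "y \<in> sphere_at G 3 z" for y
    using c3_eq[OF y] quotient_less Y_params(1)[OF sphere_3(1)[OF y]] by simp
  then have z_eccentricity: "eccentricity G z = ereal (real 4)"
    using eccentricity_of_other_part[of 3 z] Y_params(2) \<open>Y \<noteq> {}\<close> z by simp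
  have "w \<in> Z" if "w \<in> sphere_at G 4 z" for w
    using that z_verts z_notin even_ndist_iff[of z w] verts_eq by (auto simp: mem_sphere_at_iff)
  then have "c_num G z 4 w = l" if "w \<in> sphere_at G 4 z" for w
    using that c_num_eq_out_degree[OF z_verts z_eccentricity] Z_degree by simp
  then show ?thesis
    using z_verts Z_degree[OF z] z_eccentricity c2_eq c3_eq
    by (simp add: locally_distance_regular_eccentricity_4_iff)
qed

end

theorem theorem4p7:
  fixes G :: "('a, 'b) pre_digraph" and Y Z :: "'a set"
    and k l c2Y c3Y c2Z :: nat
  assumes "graph G"
    and "bipartition G Y Z"
    and "Y \<noteq> {}"
    and "\<forall>y \<in> Y. out_degree G y = k"
    and "\<forall>z \<in> Z. out_degree G z = l"
    and "\<forall>y \<in> Y. locally_distance_regular G y k [1, real c2Y, real c3Y, real k]"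
    and "\<forall>z \<in> Z. \<forall>w \<in> sphere_at G 2 z. card (nbrs G z \<inter> nbrs G w) = c2Z"
    and "real k > real c2Y * real c3Y / real c2Z"
  shows "distance_biregular G Y Z \<and>
    has_intersection_array G Y Z
      k [1, real c2Y, real c3Y, real k]
      l [1, real c2Z, real c2Y * real c3Y / real c2Z, real l]"
proof -
  interpret graph G by fact
  obtain y where "y \<in> Y"
    using \<open>Y \<noteq> {}\<close> by auto
  then have "y \<in> verts G" "eccentricity G y \<noteq> \<infinity>"
    using assms(2,6) by (auto simp: bipartition_def locally_distance_regular_def)
  then interpret connected_bipartite_graph G Y Z
    using assms(2) connected_if_eccentricity_finite by unfold_locales auto
  have "locally_distance_regular G z l [1, real c2Z, real c2Y * real c3Y / real c2Z, real l]"
    if "z \<in> Z" for z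
    using assms(3,5-8) that by (intro locally_distance_regular_of_other_part[where k = k]) auto
  then have "has_intersection_array G Y Z k [1, real c2Y, real c3Y, real k]
      l [1, real c2Z, real c2Y * real c3Y / real c2Z, real l]"
    using assms(6) by (simp add: has_intersection_array_def)
  then show ?thesis
    using distance_biregular_if_has_intersection_array by blast
qed

end
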